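(* Let $0\le\epsilon<1$. For each natural number $n$, let $d(n,\epsilon)$ be the smallest constant such that $$\sum_{k=1}^{n}\Big(\frac{1}{k}\sum_{j=1}^{k}a_j\Big)^2 k^\epsilon\le d(n,\epsilon)\,\sum_{k=1}^{n}a_k^2\,k^\epsilon$$ holds for all real numbers $a_1,\dots,a_n$. Then there exist constants $c_1=c_1(\epsilon)>0$ and $c_2=c_2(\epsilon)>0$, depending only on $\epsilon$, such that for every natural number $n\ge 2$ $$\frac{4}{(1-\epsilon)^2}-\frac{c_1}{\ln^2 n} \le d(n,\epsilon) \le \frac{4}{(1-\epsilon)^2}-\frac{c_2}{\ln^2 n}.$$
   Context: Here $\ln$ is the natural logarithm and $\ln^2 n=(\ln n)^2$. *)

theory Defs
  imports "HOL-Analysis.Analysis"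
begin

text \<open>Only the values \<open>a 1, \<dots>, a n\<close> of the function \<open>a\<close> are used.\<close>

definition weighted_hardy_ineq :: "nat \<Rightarrow> real \<Rightarrow> real \<Rightarrow> bool" where
  "weighted_hardy_ineq n \<epsilon> C \<longleftrightarrow>
     (\<forall>a :: nat \<Rightarrow> real.
        (\<Sum>k=1..n. (1 / real k * (\<Sum>j=1..k. a j))\<^sup>2 * real k powr \<epsilon>)
          \<le> C * (\<Sum>k=1..n. (a k)\<^sup>2 * real k powr \<epsilon>))"

text \<open>For \<open>n = 0\<close> every constant is admissible, so there is no smallest one and the value is
  unspecified. For \<open>n \<ge> 1\<close> and \<open>\<epsilon> \<ge> 0\<close> the lemmas below show that a smallest
  constant exists.\<close>

definition hardy_const :: "nat \<Rightarrow> real \<Rightarrow> real" where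
  "hardy_const n \<epsilon> = (LEAST C. weighted_hardy_ineq n \<epsilon> C)"

lemma weighted_hardy_ineq_exists:
  assumes "\<epsilon> \<ge> 0"
  shows "weighted_hardy_ineq n \<epsilon> (\<Sum>k=1..n. real k powr \<epsilon> / real k)"
  unfolding weighted_hardy_ineq_def
proof
  fix a :: "nat \<Rightarrow> real"
  let ?R = "\<Sum>k=1..n. (a k)\<^sup>2 * real k powr \<epsilon>"
  have "(1 / real k * (\<Sum>j=1..k. a j))\<^sup>2 * real k powr \<epsilon> \<le> real k powr \<epsilon> / real k * ?R"
    if k: "k \<in> {1..n}" for k
  proof -
    have "(\<Sum>j=1..k. a j)\<^sup>2 \<le> real k * (\<Sum>j=1..k. (a j)\<^sup>2)"
      using Cauchy_Schwarz_ineq_sum[of "\<lambda>_. 1" a "{1..k}"] by simp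
    also have "(\<Sum>j=1..k. (a j)\<^sup>2) \<le> (\<Sum>j=1..k. (a j)\<^sup>2 * real j powr \<epsilon>)"
    proof (rule sum_mono)
      fix j assume "j \<in> {1..k}"
      then have "1 \<le> real j powr \<epsilon>" using assms by (simp add: ge_one_powr_ge_zero)
      then show "(a j)\<^sup>2 \<le> (a j)\<^sup>2 * real j powr \<epsilon>"
        by (simp add: mult_le_cancel_left1)
    qed
    also have "\<dots> \<le> ?R" using k by (intro sum_mono2) auto
    finally have "(\<Sum>j=1..k. a j)\<^sup>2 \<le> real k * ?R" by (simp add: mult_left_mono)
    then have "(\<Sum>j=1..k. a j)\<^sup>2 * (real k powr \<epsilon> / (real k)\<^sup>2)
        \<le> real k * ?R * (real k powr \<epsilon> / (real k)\<^sup>2)"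
      by (intro mult_right_mono) auto
    then show ?thesis using k by (simp add: power_divide power2_eq_square mult_ac)
  qed
  then have "(\<Sum>k=1..n. (1 / real k * (\<Sum>j=1..k. a j))\<^sup>2 * real k powr \<epsilon>)
      \<le> (\<Sum>k=1..n. real k powr \<epsilon> / real k * ?R)"
    by (rule sum_mono)
  then show "(\<Sum>k=1..n. (1 / real k * (\<Sum>j=1..k. a j))\<^sup>2 * real k powr \<epsilon>)
      \<le> (\<Sum>k=1..n. real k powr \<epsilon> / real k) * ?R"
    by (simp only: sum_distrib_right)
qed

lemma weighted_hardy_ineq_nonneg:
  assumes "n \<ge> 1" "weighted_hardy_ineq n \<epsilon> C"
  shows "C \<ge> 0"
proof -
  have "0 \<le> (\<Sum>k=1..n. (1 / real k * (\<Sum>j=1..k. 1))\<^sup>2 * real k powr \<epsilon>)"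
    by (intro sum_nonneg) auto
  also have "\<dots> \<le> C * (\<Sum>k=1..n. 1\<^sup>2 * real k powr \<epsilon>)"
    using assms(2) unfolding weighted_hardy_ineq_def by (elim allE[of _ "\<lambda>_. 1"])
  finally have "0 \<le> C * (\<Sum>k=1..n. real k powr \<epsilon>)" by simp
  moreover have "0 < (\<Sum>k=1..n. real k powr \<epsilon>)"
    using assms(1) by (intro sum_pos) auto
  ultimately show ?thesis by (simp add: zero_le_mult_iff)
qed

lemma weighted_hardy_ineq_Inf:
  assumes "n \<ge> 1" "\<epsilon> \<ge> 0"
  shows "weighted_hardy_ineq n \<epsilon> (Inf {C. weighted_hardy_ineq n \<epsilon> C})"
proof -
  have "{C. weighted_hardy_ineq n \<epsilon> C} = (\<Inter>a :: nat \<Rightarrow> real. {C.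
        (\<Sum>k=1..n. (1 / real k * (\<Sum>j=1..k. a j))\<^sup>2 * real k powr \<epsilon>)
          \<le> C * (\<Sum>k=1..n. (a k)\<^sup>2 * real k powr \<epsilon>)})"
    by (auto simp: weighted_hardy_ineq_def)
  also have "closed \<dots>"
    by (intro closed_INT ballI closed_Collect_le continuous_intros)
  finally have "closed {C. weighted_hardy_ineq n \<epsilon> C}" .
  moreover have "{C. weighted_hardy_ineq n \<epsilon> C} \<noteq> {}"
    using weighted_hardy_ineq_exists[OF assms(2)] by blast
  moreover have "bdd_below {C. weighted_hardy_ineq n \<epsilon> C}"
    using weighted_hardy_ineq_nonneg[OF assms(1)] by (intro bdd_belowI[of _ 0]) auto
  ultimately have "Inf {C. weighted_hardy_ineq n \<epsilon> C} \<in> {C. weighted_hardy_ineq n \<epsilon> C}"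
    by (intro closed_contains_Inf)
  then show ?thesis by simp
qed

lemma hardy_const_eq_Inf:
  assumes "n \<ge> 1" "\<epsilon> \<ge> 0"
  shows "hardy_const n \<epsilon> = Inf {C. weighted_hardy_ineq n \<epsilon> C}"
  unfolding hardy_const_def
proof (rule Least_equality)
  show "weighted_hardy_ineq n \<epsilon> (Inf {C. weighted_hardy_ineq n \<epsilon> C})"
    by (rule weighted_hardy_ineq_Inf[OF assms])
  show "Inf {C. weighted_hardy_ineq n \<epsilon> C} \<le> C" if "weighted_hardy_ineq n \<epsilon> C" for C
    using that weighted_hardy_ineq_nonneg[OF assms(1)]
    by (intro cInf_lower bdd_belowI[of _ 0]) auto
qed

lemma weighted_hardy_ineq_hardy_const:
  assumes "n \<ge> 1" "\<epsilon> \<ge> 0"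
  shows "weighted_hardy_ineq n \<epsilon> (hardy_const n \<epsilon>)"
  using weighted_hardy_ineq_Inf[OF assms] hardy_const_eq_Inf[OF assms] by simp

lemma hardy_const_le:
  assumes "n \<ge> 1" "\<epsilon> \<ge> 0" "weighted_hardy_ineq n \<epsilon> C"
  shows "hardy_const n \<epsilon> \<le> C"
  unfolding hardy_const_eq_Inf[OF assms(1,2)]
  using assms(3) weighted_hardy_ineq_nonneg[OF assms(1)]
  by (intro cInf_lower bdd_belowI[of _ 0]) auto

end

theory Submission
  imports Defs
begin

text \<open>
  Put \<open>b = (1 - \<epsilon>) / 2\<close>, so that \<open>0 < b \<le> 1/2\<close> and the limiting constant is \<open>1 / b\<^sup>2\<close>. In the
  continuous inequality this constant would be attained by the function with primitive \<open>x powr b\<close>,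
  were it not for the divergence of the integrals. The idea is to factor it out of the partial sums:
  with \<open>a 1 + \<dots> + a k = k powr b * u k\<close> the left-hand side of the Hardy inequality becomes
  \<open>S = (\<Sum>k=1..n. (u k)\<^sup>2 / k)\<close>, and the right-hand side becomes an energy \<open>E\<close> of \<open>u\<close>. Summation by
  parts (\<open>energy_decomposition\<close>) splits \<open>E\<close> into three nonnegative parts: a Dirichlet form that is
  essentially \<open>\<Sum>k * (u k - u (k - 1))\<^sup>2\<close>, a potential term that is essentially \<open>b\<^sup>2 * S\<close>, and a
  boundary term comparable to \<open>(u n)\<^sup>2\<close>. That the potential is at least \<open>b\<^sup>2 * S\<close>, with relative
  error \<open>O(1 / k)\<close> at \<open>k\<close>, is a calculus estimate in the variable \<open>1 / k\<close> (\<open>flux_drop_ge\<close>,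
  \<open>flux_drop_le\<close>).

  In the variable \<open>t = ln k\<close>, which runs over an interval of length \<open>L = ln n\<close>, the sum \<open>S\<close> looks like
  \<open>\<integral> u\<^sup>2 dt\<close> and the Dirichlet form like \<open>\<integral> (u')\<^sup>2 dt\<close>. So the reciprocal of the best constant exceeds
  \<open>b\<^sup>2\<close> by roughly the lowest eigenvalue of an interval of length \<open>L\<close>, which is of order \<open>1 / L\<^sup>2\<close>. Only the
  order matters here. The eigenvalue is bounded from below by a Poincare inequality, which follows
  from Cauchy-Schwarz (\<open>hardy_remainder\<close>), and from above by the test function \<open>t * (L - t)\<close>
  (\<open>energy_log_bump_le\<close>, \<open>log_bump_norm_ge\<close>). Passing to reciprocals gives both bounds.
\<close>

section \<open>The potential of the ground state\<close>

lemma nonneg_of_second_derivative_nonneg: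
  fixes g g' g'' :: "real \<Rightarrow> real"
  assumes g: "\<And>x. 0 \<le> x \<Longrightarrow> x < c \<Longrightarrow> (g has_real_derivative g' x) (at x)"
    and g': "\<And>x. 0 \<le> x \<Longrightarrow> x < c \<Longrightarrow> (g' has_real_derivative g'' x) (at x)"
    and nonneg: "\<And>x. 0 \<le> x \<Longrightarrow> x < c \<Longrightarrow> 0 \<le> g'' x"
    and zero: "g 0 = 0" "g' 0 = 0"
    and x: "0 \<le> x" "x < c"
  shows "0 \<le> g x"
proof -
  have "0 \<le> g' y" if "0 \<le> y" "y < c" for y
    using DERIV_nonneg_imp_nondecreasing[of 0 y g'] that g' nonneg zero(2)
    by (metis order.strict_trans1)
  then show ?thesis
    using DERIV_nonneg_imp_nondecreasing[of 0 x g] x g zero(1)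
    by (metis order.strict_trans1)
qed

text \<open>The weighted increment of the ground state \<open>k powr b\<close>, the discrete counterpart of
  \<open>x powr \<epsilon> * h' x\<close> for \<open>h x = x powr b\<close>. Its decrease from \<open>k\<close> to \<open>k + 1\<close>, divided by
  \<open>k powr b\<close>, is the potential that the ground state produces.\<close>

definition flux :: "real \<Rightarrow> nat \<Rightarrow> real" where
  "flux b k = real k powr (1 - 2 * b) * (real k powr b - real (k - 1) powr b)"

text \<open>The rescaled difference of consecutive fluxes as a function of \<open>x = 1 / k\<close>; the exact relation
  is \<open>flux_diff\<close>. The other two functions are its first and second derivative.\<close>

definition flux_drop :: "real \<Rightarrow> real \<Rightarrow> real" where
  "flux_drop b x = 1 - (1 - x) powr b - (1 + x) powr (1 - b) + (1 + x) powr (1 - 2 * b)"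

definition flux_drop' :: "real \<Rightarrow> real \<Rightarrow> real" where
  "flux_drop' b x = b * (1 - x) powr (b - 1) - (1 - b) * (1 + x) powr (- b)
     + (1 - 2 * b) * (1 + x) powr (- 2 * b)"

definition flux_drop'' :: "real \<Rightarrow> real \<Rightarrow> real" where
  "flux_drop'' b x = b * ((1 - b) * ((1 - x) powr (b - 2) + (1 + x) powr (- b - 1))
     - 2 * (1 - 2 * b) * (1 + x) powr (- 2 * b - 1))"

lemma flux_drop_deriv:
  assumes "0 \<le> x" "x < 1"
  shows "(flux_drop b has_real_derivative flux_drop' b x) (at x)"
proof -
  have "1 - b - 1 = - b" "1 - 2 * b - 1 = - 2 * b" by simp_all
  then show ?thesis
    unfolding flux_drop_def[abs_def] flux_drop'_def using assms
    by (auto intro!: derivative_eq_intros simp: algebra_simps)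
qed

lemma flux_drop'_deriv:
  assumes "0 \<le> x" "x < 1"
  shows "(flux_drop' b has_real_derivative flux_drop'' b x) (at x)"
proof -
  have "b - 1 - 1 = b - 2" by simp
  then show ?thesis
  unfolding flux_drop'_def[abs_def] flux_drop''_def using assms
  by (auto intro!: derivative_eq_intros simp: algebra_simps)
qed

lemma flux_drop_0: "flux_drop b 0 = 0" "flux_drop' b 0 = 0"
  by (simp_all add: flux_drop_def flux_drop'_def)

text \<open>At \<open>x = 0\<close> equality holds. For \<open>x > 0\<close> the negative term is bounded by its value at \<open>0\<close>, and
  the two positive ones are bounded with the arithmetic-geometric mean inequality, since
  \<open>(1 - x) powr (b - 2) \<ge> (1 + x) powr (2 - b)\<close> and
  \<open>(1 + x) powr (2 - b) * (1 + x) powr (- b - 1) = (1 + x) powr (1 - 2 * b) \<ge> 1\<close>. The sign of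
  the negative term and the last inequality depend on \<open>b \<le> 1/2\<close>, that is, on \<open>\<epsilon> \<ge> 0\<close>.\<close>

lemma flux_drop''_ge:
  assumes b: "0 < b" "b \<le> 1/2" and x: "0 \<le> x" "x < 1"
  shows "2 * b\<^sup>2 \<le> flux_drop'' b x"
proof -
  define p where "p = (1 + x) powr (2 - b)"
  define q where "q = (1 + x) powr (- b - 1)"
  have "(1 + x) * (1 - x) \<le> 1" by (simp add: algebra_simps)
  then have "1 + x \<le> 1 / (1 - x)" using x by (simp add: field_simps)
  then have "p \<le> (1 / (1 - x)) powr (2 - b)"
    unfolding p_def using x b by (intro powr_mono2) auto
  also have "\<dots> = (1 - x) powr (b - 2)"
    using x by (simp add: powr_divide powr_minus_divide[symmetric])
  finally have 1: "p \<le> (1 - x) powr (b - 2)" .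
  have "p * q = (1 + x) powr (1 - 2 * b)"
    by (simp add: p_def q_def powr_add[symmetric])
  also have "\<dots> \<ge> 1" using x b by (intro ge_one_powr_ge_zero) auto
  finally have "1 \<le> p * q" .
  moreover have "0 \<le> (p - q)\<^sup>2" by simp
  ultimately have "2\<^sup>2 \<le> (p + q)\<^sup>2" by (simp add: power2_eq_square algebra_simps)
  moreover have "0 \<le> p + q" by (simp add: p_def q_def)
  ultimately have 2: "2 \<le> p + q" by (rule power2_le_imp_le)
  have "(1 + x) powr (- 2 * b - 1) \<le> (1 + x) powr 0"
    using x b by (intro powr_mono) auto
  then have 3: "(1 + x) powr (- 2 * b - 1) \<le> 1" using x by simp
  have "(1 - b) * 2 \<le> (1 - b) * ((1 - x) powr (b - 2) + q)"
    using 1 2 b by (intro mult_left_mono) auto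
  moreover have "2 * (1 - 2 * b) * (1 + x) powr (- 2 * b - 1) \<le> 2 * (1 - 2 * b) * 1"
    using 3 b by (intro mult_left_mono) auto
  ultimately have "2 * b \<le> (1 - b) * ((1 - x) powr (b - 2) + q)
      - 2 * (1 - 2 * b) * (1 + x) powr (- 2 * b - 1)" by (simp add: algebra_simps)
  then have "b * (2 * b) \<le> flux_drop'' b x"
    unfolding flux_drop''_def q_def using b by (intro mult_left_mono) auto
  then show ?thesis by (simp add: power2_eq_square)
qed

lemma flux_drop''_le:
  assumes b: "0 < b" "b \<le> 1/2" and x: "0 \<le> x" "x \<le> 1/2"
  shows "flux_drop'' b x \<le> 2 * b\<^sup>2 + 6 * x"
proof -
  have "(1 - x) powr (b - 2) \<le> (1 - x) powr (-2)"
    using x b by (intro powr_mono') auto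
  also have "\<dots> = 1 / (1 - x)\<^sup>2"
    using x by (simp add: powr_minus_divide powr_numeral)
  also have "\<dots> \<le> 1 + 6 * x"
  proof -
    have "0 \<le> x * (4 - 11 * x + 6 * x\<^sup>2)"
    proof -
      have "4 - 11 * x + 6 * x\<^sup>2 = (1 - 2 * x) * (4 - 3 * x)"
        by (simp add: power2_eq_square algebra_simps)
      then show ?thesis using x by simp
    qed
    then have "1 \<le> (1 + 6 * x) * (1 - x)\<^sup>2"
      by (simp add: power2_eq_square algebra_simps)
    then show ?thesis using x by (simp add: field_simps)
  qed
  finally have 1: "(1 - x) powr (b - 2) \<le> 1 + 6 * x" .
  have "(1 + x) powr (- b - 1) \<le> (1 + x) powr 0"
    using x b by (intro powr_mono) auto
  then have 2: "(1 + x) powr (- b - 1) \<le> 1" using x by simp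
  have "1 - 2 * x \<le> 1 / (1 + x)\<^sup>2"
  proof -
    have "0 \<le> x\<^sup>2 * (3 + 2 * x)" using x by simp
    then have "(1 - 2 * x) * (1 + x)\<^sup>2 \<le> 1" by (simp add: power2_eq_square algebra_simps)
    then show ?thesis using x by (simp add: field_simps)
  qed
  also have "\<dots> = (1 + x) powr (-2)"
    using x by (simp add: powr_minus_divide powr_numeral)
  also have "\<dots> \<le> (1 + x) powr (- 2 * b - 1)"
    using x b by (intro powr_mono) auto
  finally have 3: "1 - 2 * x \<le> (1 + x) powr (- 2 * b - 1)" .
  have "(1 - b) * ((1 - x) powr (b - 2) + (1 + x) powr (- b - 1)) \<le> (1 - b) * (2 + 6 * x)"
    using 1 2 b by (intro mult_left_mono) auto
  moreover have "2 * (1 - 2 * b) * (1 - 2 * x) \<le> 2 * (1 - 2 * b) * (1 + x) powr (- 2 * b - 1)"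
    using 3 b by (intro mult_left_mono) auto
  moreover have "0 \<le> b * x" using b x by simp
  ultimately have "(1 - b) * ((1 - x) powr (b - 2) + (1 + x) powr (- b - 1))
      - 2 * (1 - 2 * b) * (1 + x) powr (- 2 * b - 1) \<le> 2 * b + 10 * x"
    by (simp add: algebra_simps)
  then have "flux_drop'' b x \<le> b * (2 * b + 10 * x)"
    unfolding flux_drop''_def using b by (intro mult_left_mono) auto
  also have "\<dots> \<le> 2 * b\<^sup>2 + 6 * x"
    using mult_right_mono[of b "1/2" x] b x by (simp add: power2_eq_square algebra_simps)
  finally show ?thesis .
qed

text \<open>The second derivatives of both sides are compared by \<open>flux_drop''_ge\<close>. That comparison needs
  \<open>x < 1\<close>, because the second derivative blows up at \<open>1\<close>. The value at \<open>x = 1\<close>, which belongs to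
  \<open>k = 1\<close>, is the quadratic polynomial \<open>(1 - z)\<^sup>2 + z\<^sup>2\<close> in \<open>z = 2 powr (- b)\<close>.\<close>

lemma flux_drop_ge:
  assumes b: "0 < b" "b \<le> 1/2" and x: "0 \<le> x" "x \<le> 1"
  shows "b\<^sup>2 * x\<^sup>2 \<le> flux_drop b x"
proof (cases "x < 1")
  case True
  have "0 \<le> flux_drop b x - b\<^sup>2 * x\<^sup>2"
  proof (rule nonneg_of_second_derivative_nonneg[where c = 1 and x = x
        and g = "\<lambda>x. flux_drop b x - b\<^sup>2 * x\<^sup>2" and g' = "\<lambda>x. flux_drop' b x - 2 * b\<^sup>2 * x" and g'' = "\<lambda>x. flux_drop'' b x - 2 * b\<^sup>2"])
    fix x :: real assume "0 \<le> x" "x < 1"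
    then show "((\<lambda>x. flux_drop b x - b\<^sup>2 * x\<^sup>2) has_real_derivative
        flux_drop' b x - 2 * b\<^sup>2 * x) (at x)"
      by (auto intro!: derivative_eq_intros flux_drop_deriv)
  next
    fix x :: real assume "0 \<le> x" "x < 1"
    then show "((\<lambda>x. flux_drop' b x - 2 * b\<^sup>2 * x) has_real_derivative
        flux_drop'' b x - 2 * b\<^sup>2) (at x)"
      by (auto intro!: derivative_eq_intros flux_drop'_deriv)
  qed (use flux_drop''_ge[OF b] x True in \<open>auto simp: flux_drop_0\<close>)
  then show ?thesis by simp
next
  case False
  then have [simp]: "x = 1" using x by simp
  define z :: real where "z = 2 powr (- b)"
  have "(2::real) powr (- (1/2)) \<le> z" unfolding z_def using b by (intro powr_mono) auto
  then have "((2::real) powr (- (1/2)))\<^sup>2 \<le> z\<^sup>2" by (intro power_mono) auto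
  then have z: "1/2 \<le> z\<^sup>2"
    by (simp add: power2_eq_square powr_add[symmetric] powr_minus_divide)
  have "b\<^sup>2 \<le> (1/2)\<^sup>2" using b by (intro power_mono) auto
  then have "b\<^sup>2 \<le> 1/4" by (simp add: power_divide)
  then have "b\<^sup>2 \<le> (1 - z)\<^sup>2 + z\<^sup>2"
    using z zero_le_power2[of "1 - z"] by linarith
  also have "\<dots> = flux_drop b 1"
    by (simp add: flux_drop_def z_def power2_eq_square algebra_simps powr_add[symmetric]
        powr_minus_divide powr_diff)
  finally show ?thesis by simp
qed

text \<open>The converse estimate shows that the potential of the ground state exceeds the Hardy potential
  only at lower order. The range \<open>x \<le> 1/2\<close> covers all \<open>k \<ge> 2\<close>, and the test function used below
  vanishes at \<open>k = 1\<close>.\<close>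

lemma flux_drop_le:
  assumes b: "0 < b" "b \<le> 1/2" and x: "0 \<le> x" "x \<le> 1/2"
  shows "flux_drop b x \<le> b\<^sup>2 * x\<^sup>2 + x ^ 3"
proof -
  define g where "g = (\<lambda>x. b\<^sup>2 * x\<^sup>2 + x ^ 3 - flux_drop b x)"
  define g' where "g' = (\<lambda>x. 2 * b\<^sup>2 * x + 3 * x\<^sup>2 - flux_drop' b x)"
  define g'' where "g'' = (\<lambda>x. 2 * b\<^sup>2 + 6 * x - flux_drop'' b x)"
  have g: "(g has_real_derivative g' y) (at y)" if "0 \<le> y" "y < 1" for y
    unfolding g_def g'_def using that
    by (auto intro!: derivative_eq_intros flux_drop_deriv)
  have g': "(g' has_real_derivative g'' y) (at y)" if "0 \<le> y" "y < 1" for y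
    unfolding g'_def g''_def using that
    by (auto intro!: derivative_eq_intros flux_drop'_deriv)
  have nonneg: "0 \<le> g y" if "0 \<le> y" "y < 1/2" for y
    by (rule nonneg_of_second_derivative_nonneg[of "1/2" g g' g''])
      (use that g g' flux_drop''_le[OF b] in \<open>auto simp: flux_drop_0 g_def g'_def g''_def\<close>)
  have "0 \<le> g x"
  proof (cases "x = 0")
    case False
    have "((\<lambda>y. g y) \<longlongrightarrow> g x) (at_left x)"
      using DERIV_isCont[OF g[of x]] x by (auto simp: isCont_def filterlim_at_split)
    moreover have "eventually (\<lambda>y. 0 \<le> g y) (at_left x)"
      using eventually_at_left_real[of 0 x] x False nonneg
      by (auto elim!: eventually_mono)
    ultimately show ?thesis by (intro tendsto_lowerbound) auto
  qed (use nonneg[of 0] in simp)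
  then show ?thesis by (simp add: g_def)
qed

section \<open>Factoring out the ground state\<close>

text \<open>The discrete ground state representation. Pointwise, \<open>(h u - g v)\<^sup>2\<close> equals
  \<open>h g (u - v)\<^sup>2 + (h - g) (h u\<^sup>2 - g v\<^sup>2)\<close>, and Abel summation moves the difference in the second
  summand to the flux \<open>f\<close>.\<close>

lemma ground_state_identity:
  fixes w h u :: "nat \<Rightarrow> real"
  assumes "h 0 = 0"
  defines "f \<equiv> \<lambda>k. w k * (h k - h (k - 1))"
  shows "(\<Sum>k=1..n. w k * (h k * u k - h (k - 1) * u (k - 1))\<^sup>2) =
     (\<Sum>k=1..n. w k * h k * h (k - 1) * (u k - u (k - 1))\<^sup>2)
     + (\<Sum>k=1..n. (f k - f (k + 1)) * h k * (u k)\<^sup>2) + f (n + 1) * h n * (u n)\<^sup>2"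
  using assms
  by (induction n) (auto simp: algebra_simps power2_eq_square)

text \<open>The two fluxes are built from powers of \<open>k - 1\<close>, \<open>k\<close> and \<open>k + 1\<close>; taking \<open>k\<close> out of the
  bases leaves powers of \<open>1 - 1 / k\<close> and \<open>1 + 1 / k\<close>.\<close>

lemma flux_diff:
  assumes "k \<ge> 1"
  shows "(flux b k - flux b (k + 1)) * real k powr b = real k * flux_drop b (1 / real k)"
proof -
  define x where "x = 1 / real k"
  have k: "real k > 0" using assms by simp
  have km: "real (k - 1) powr b = real k powr b * (1 - x) powr b"
    using assms k by (subst powr_mult[symmetric]) (auto simp: x_def right_diff_distrib of_nat_diff)
  have kp: "real (k + 1) powr s = real k powr s * (1 + x) powr s" for s
    using assms k by (subst powr_mult[symmetric]) (auto simp: x_def distrib_left add.commute)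
  have 1: "real k powr (1 - 2 * b) * real k powr b * real k powr b = real k"
    using k by (simp add: powr_add[symmetric])
  have 2: "(1 + x) powr (1 - 2 * b) * (1 + x) powr b = (1 + x) powr (1 - b)"
    by (simp add: powr_add[symmetric])
  have "(flux b k - flux b (k + 1)) * real k powr b
      = (real k powr (1 - 2 * b) * real k powr b * real k powr b) *
        (1 - (1 - x) powr b - ((1 + x) powr (1 - 2 * b) * (1 + x) powr b)
          + (1 + x) powr (1 - 2 * b))"
    unfolding flux_def km kp by (simp add: km algebra_simps)
  then show ?thesis unfolding 1 2 by (simp add: flux_drop_def x_def)
qed

text \<open>By the mean value theorem \<open>flux b (n + 1)\<close> is at least \<open>b * (n + 1) powr (- b)\<close>, and
  \<open>n / (n + 1) \<ge> 1/2\<close>.\<close>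

lemma flux_boundary_ge:
  assumes b: "0 < b" "b \<le> 1/2" and n: "n \<ge> 1"
  shows "b / 2 \<le> flux b (n + 1) * real n powr b"
proof -
  define m where "m = real n + 1"
  have m: "m > 0" "m > 1" using n by (auto simp: m_def)
  have n_eq: "real n = m * (1 - 1 / m)" using m by (simp add: field_simps m_def)
  have "\<exists>z. real n < z \<and> z < m \<and> m powr b - real n powr b = (m - real n) * (b * z powr (b - 1))"
    using n b by (intro MVT2) (auto simp: m_def intro!: derivative_eq_intros)
  then obtain z where z: "real n < z" "z < m" "m powr b - real n powr b = b * z powr (b - 1)"
    by (auto simp: m_def)
  have "m powr (b - 1) \<le> z powr (b - 1)"
    using z n b by (intro powr_mono2') auto
  then have "b * m powr (b - 1) \<le> m powr b - real n powr b"
    using z b by simp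
  then have "m powr (1 - 2 * b) * (b * m powr (b - 1)) * real n powr b
      \<le> flux b (n + 1) * real n powr b"
    unfolding flux_def
    by (intro mult_right_mono) (auto simp: m_def add.commute intro!: mult_left_mono)
  moreover have "m powr (1 - 2 * b) * (b * m powr (b - 1)) * real n powr b
      = b * (real n / m) powr b"
  proof -
    have "m powr (1 - 2 * b) * m powr (b - 1) = 1 / m powr b"
      using m by (simp add: powr_add[symmetric] powr_minus_divide[symmetric])
    moreover have "(real n / m) powr b = real n powr b / m powr b"
      using m by (simp add: powr_divide)
    ultimately show ?thesis by (simp add: mult.left_commute)
  qed
  moreover have "(1/2) powr 1 \<le> (real n / m) powr b"
  proof -
    have "(1/2::real) powr 1 \<le> (1/2) powr b" using b by (intro powr_mono') auto
    also have "\<dots> \<le> (real n / m) powr b" using b n by (intro powr_mono2) (auto simp: m_def field_simps)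
    finally show ?thesis .
  qed
  ultimately have "b * (1/2) \<le> b * (real n / m) powr b" "b * (real n / m) powr b \<le> flux b (n + 1) * real n powr b"
    using b by (auto intro!: mult_left_mono simp del: mult_le_cancel_left_pos)
  then show ?thesis by simp
qed

text \<open>The weighted sum of the squares of \<open>a k\<close> when \<open>a\<close> has the partial sums \<open>k powr b * u k\<close>.\<close>

definition energy :: "real \<Rightarrow> nat \<Rightarrow> (nat \<Rightarrow> real) \<Rightarrow> real" where
  "energy b n u = (\<Sum>k=1..n. real k powr (1 - 2 * b) *
     (real k powr b * u k - real (k - 1) powr b * u (k - 1))\<^sup>2)"

lemma energy_decomposition:
  "energy b n u = (\<Sum>k=1..n. real k powr (1 - b) * real (k - 1) powr b * (u k - u (k - 1))\<^sup>2)
     + (\<Sum>k=1..n. real k * flux_drop b (1 / real k) * (u k)\<^sup>2)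
     + flux b (n + 1) * real n powr b * (u n)\<^sup>2"
proof -
  have "(\<Sum>k=1..n. (flux b k - flux b (k + 1)) * real k powr b * (u k)\<^sup>2)
      = (\<Sum>k=1..n. real k * flux_drop b (1 / real k) * (u k)\<^sup>2)"
    by (intro sum.cong) (simp_all only: flux_diff atLeastAtMost_iff)
  then show ?thesis
    using ground_state_identity[of "\<lambda>k. real k powr b" "\<lambda>k. real k powr (1 - 2 * b)" u n]
    unfolding energy_def flux_def by (simp add: powr_add[symmetric])
qed

text \<open>The map \<open>u \<mapsto> a\<close> is onto, because \<open>k powr b > 0\<close> for \<open>k \<ge> 1\<close>. At \<open>k = 0\<close> both the empty partial
  sum and \<open>0 powr b\<close> are \<open>0\<close>, so the value \<open>u 0\<close> is immaterial.\<close>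

lemma weighted_hardy_ineq_iff_energy:
  "weighted_hardy_ineq n (1 - 2 * b) C \<longleftrightarrow>
     (\<forall>u. (\<Sum>k=1..n. (u k)\<^sup>2 / real k) \<le> C * energy b n u)"
proof -
  have lhs: "(\<Sum>k=1..n. (1 / real k * (\<Sum>j=1..k. a j))\<^sup>2 * real k powr (1 - 2 * b))
      = (\<Sum>k=1..n. (u k)\<^sup>2 / real k)"
    if "\<And>k. (\<Sum>j=1..k. a j) = real k powr b * u k" for a u
  proof (intro sum.cong refl)
    fix k assume "k \<in> {1..n}"
    then have k: "real k > 0" by simp
    have "real k powr b * real k powr b * real k powr (1 - 2 * b) = real k"
      using k by (simp add: powr_add[symmetric])
    then have "(1 / real k)\<^sup>2 * (u k)\<^sup>2 * (real k powr b * real k powr b * real k powr (1 - 2 * b))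
        = (u k)\<^sup>2 / real k"
      using k by (simp add: power2_eq_square)
    then show "(1 / real k * (\<Sum>j=1..k. a j))\<^sup>2 * real k powr (1 - 2 * b) = (u k)\<^sup>2 / real k"
      unfolding that by (simp add: power2_eq_square mult_ac)
  qed
  have rhs: "(\<Sum>k=1..n. (a k)\<^sup>2 * real k powr (1 - 2 * b)) = energy b n u"
    if A: "\<And>k. (\<Sum>j=1..k. a j) = real k powr b * u k" for a u
    unfolding energy_def
  proof (intro sum.cong refl)
    fix k assume "k \<in> {1..n}"
    then obtain m where m: "k = Suc m" by (cases k) auto
    have "a k = real k powr b * u k - real (k - 1) powr b * u (k - 1)"
      using A[of k] A[of m] unfolding m by simp
    then show "(a k)\<^sup>2 * real k powr (1 - 2 * b) = real k powr (1 - 2 * b) *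
        (real k powr b * u k - real (k - 1) powr b * u (k - 1))\<^sup>2"
      by simp
  qed
  show ?thesis
  proof (intro iffI allI)
    fix u :: "nat \<Rightarrow> real"
    assume H: "weighted_hardy_ineq n (1 - 2 * b) C"
    define a where "a = (\<lambda>k. real k powr b * u k - real (k - 1) powr b * u (k - 1))"
    have A: "(\<Sum>j=1..k. a j) = real k powr b * u k" for k
      by (induction k) (auto simp: a_def)
    show "(\<Sum>k=1..n. (u k)\<^sup>2 / real k) \<le> C * energy b n u"
      using H[unfolded weighted_hardy_ineq_def, THEN spec[of _ a]] unfolding lhs[OF A] rhs[OF A] .
  next
    assume H: "\<forall>u. (\<Sum>k=1..n. (u k)\<^sup>2 / real k) \<le> C * energy b n u"
    show "weighted_hardy_ineq n (1 - 2 * b) C"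
      unfolding weighted_hardy_ineq_def
    proof
      fix a :: "nat \<Rightarrow> real"
      define u where "u = (\<lambda>k. (\<Sum>j=1..k. a j) / real k powr b)"
      have A: "(\<Sum>j=1..k. a j) = real k powr b * u k" for k
        by (cases "k = 0") (auto simp: u_def)
      show "(\<Sum>k=1..n. (1 / real k * (\<Sum>j=1..k. a j))\<^sup>2 * real k powr (1 - 2 * b))
          \<le> C * (\<Sum>k=1..n. (a k)\<^sup>2 * real k powr (1 - 2 * b))"
        using H[THEN spec[of _ u]] unfolding lhs[OF A] rhs[OF A] .
    qed
  qed
qed

section \<open>The gain from the finite length\<close>

lemma harmonic_sum_le: "n \<ge> 1 \<Longrightarrow> (\<Sum>k=1..n. 1 / real k) \<le> 1 + ln (real n)"
  using euler_mascheroni_sequence_decreasing[of 1 n]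
  by (simp add: harm_def inverse_eq_divide)

lemma harmonic_block_ge:
  assumes "1 \<le> m" "m \<le> n + 1"
  shows "ln (real n + 1) - ln (real m) \<le> (\<Sum>k=m..n. 1 / real k)"
proof (cases "m \<le> n")
  case True
  then show ?thesis
  proof (induction n rule: dec_induct)
    case base
    show ?case using ln_diff_le_inverse[of "real m"] assms by simp
  next
    case (step n)
    show ?case using ln_diff_le_inverse[of "real n + 1"] step by (simp add: add_ac)
  qed
next
  case False
  then have "m = n + 1" using assms by simp
  then show ?thesis by (simp add: add.commute)
qed

text \<open>A Poincare inequality for \<open>u\<close> on the logarithmic scale, where the interval has length about \<open>H\<close>.
  The value \<open>u n\<close> is controlled by the boundary term, and the oscillation
  \<open>(u n - u k)\<^sup>2 \<le> (\<Sum>1 / j) * (\<Sum>j * (u j - u (j - 1))\<^sup>2)\<close> by the Dirichlet form. Summing the resulting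
  bound of \<open>(u k)\<^sup>2\<close> against \<open>1 / k\<close> costs the second factor \<open>H\<close>.\<close>

lemma hardy_remainder:
  assumes b: "0 < b" "b \<le> 1/2" and n: "n \<ge> 1"
  defines "H \<equiv> \<Sum>k=1..n. 1 / real k"
  shows "(b\<^sup>2 + b / (4 * H\<^sup>2)) * (\<Sum>k=1..n. (u k)\<^sup>2 / real k) \<le> energy b n u"
proof -
  define S where "S = (\<Sum>k=1..n. (u k)\<^sup>2 / real k)"
  define R where "R = (\<Sum>k=1..n. real k powr (1 - b) * real (k - 1) powr b * (u k - u (k - 1))\<^sup>2)"
  define B where "B = flux b (n + 1) * real n powr b * (u n)\<^sup>2"
  have "H \<ge> (\<Sum>k=1..1. 1 / real k)" unfolding H_def using n by (intro sum_mono2) auto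
  then have H1: "H \<ge> 1" by simp
  have R0: "R \<ge> 0" unfolding R_def by (intro sum_nonneg) auto
  have B: "b / 2 * (u n)\<^sup>2 \<le> B"
    unfolding B_def using flux_boundary_ge[OF b n] by (intro mult_right_mono) auto
  have osc: "(u n - u k)\<^sup>2 \<le> 2 * H * R" if k: "k \<in> {1..n}" for k
  proof -
    have "u n - u k = (\<Sum>j=Suc k..n. u j - u (j - 1))"
    proof -
      have "k \<le> n" using k by simp
      then show ?thesis by (induction n rule: dec_induct) auto
    qed
    also have "\<dots> = (\<Sum>j=Suc k..n. sqrt (1 / real j) * (sqrt (real j) * (u j - u (j - 1))))"
      by (intro sum.cong) (auto simp: real_sqrt_divide)
    finally have "(u n - u k)\<^sup>2 \<le> (\<Sum>j=Suc k..n. (sqrt (1 / real j))\<^sup>2)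
        * (\<Sum>j=Suc k..n. (sqrt (real j) * (u j - u (j - 1)))\<^sup>2)"
      using Cauchy_Schwarz_ineq_sum by metis
    also have "\<dots> = (\<Sum>j=Suc k..n. 1 / real j) * (\<Sum>j=Suc k..n. real j * (u j - u (j - 1))\<^sup>2)"
      by (simp add: power_mult_distrib)
    also have "\<dots> \<le> H * (2 * R)"
    proof (intro mult_mono)
      show "(\<Sum>j=Suc k..n. 1 / real j) \<le> H"
        unfolding H_def by (intro sum_mono2) auto
      have "(\<Sum>j=Suc k..n. real j * (u j - u (j - 1))\<^sup>2)
          \<le> (\<Sum>j=Suc k..n. 2 * (real j powr (1 - b) * real (j - 1) powr b * (u j - u (j - 1))\<^sup>2))"
      proof (intro sum_mono)
        fix j assume "j \<in> {Suc k..n}"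
        then have j: "j \<ge> 2" using k by auto
        then have "real (j - 1) = real (j - 1) powr (1 - b) * real (j - 1) powr b"
          by (simp add: powr_add[symmetric])
        also have "\<dots> \<le> real j powr (1 - b) * real (j - 1) powr b"
          using b by (intro mult_right_mono powr_mono2) auto
        finally have "real j \<le> 2 * (real j powr (1 - b) * real (j - 1) powr b)"
          using j by simp
        from mult_right_mono[OF this, of "(u j - u (j - 1))\<^sup>2"]
        show "real j * (u j - u (j - 1))\<^sup>2
            \<le> 2 * (real j powr (1 - b) * real (j - 1) powr b * (u j - u (j - 1))\<^sup>2)"
          by (simp add: mult_ac)
      qed
      also have "\<dots> \<le> 2 * R"
        unfolding R_def sum_distrib_left by (intro sum_mono2) auto
      finally show "(\<Sum>j=Suc k..n. real j * (u j - u (j - 1))\<^sup>2) \<le> 2 * R" .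
    qed (use H1 in \<open>auto intro!: sum_nonneg\<close>)
    finally show ?thesis by simp
  qed
  have "S \<le> (\<Sum>k=1..n. (2 * (u n)\<^sup>2 + 4 * H * R) * (1 / real k))"
    unfolding S_def
  proof (intro sum_mono)
    fix k assume k: "k \<in> {1..n}"
    have "(u k)\<^sup>2 \<le> 2 * (u n)\<^sup>2 + 2 * (u n - u k)\<^sup>2"
      using zero_le_power2[of "2 * u n - u k"] by (simp add: power2_eq_square algebra_simps)
    also have "\<dots> \<le> 2 * (u n)\<^sup>2 + 4 * H * R" using osc[OF k] by simp
    finally show "(u k)\<^sup>2 / real k \<le> (2 * (u n)\<^sup>2 + 4 * H * R) * (1 / real k)"
      by (simp add: divide_right_mono)
  qed
  also have "\<dots> = (2 * (u n)\<^sup>2 + 4 * H * R) * H"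
    unfolding H_def by (simp only: sum_distrib_left)
  also have "\<dots> \<le> (4 / b * H * (B + R)) * H"
  proof (intro mult_right_mono)
    have "2 * (u n)\<^sup>2 \<le> 4 / b * B" using B b by (simp add: field_simps)
    also have "\<dots> \<le> 4 / b * B * H"
      using mult_left_mono[OF H1, of "4 / b * B"] B b
      by (smt (verit, best) divide_nonneg_nonneg mult_nonneg_nonneg zero_le_power2 mult_1_right)
    finally have 1: "2 * (u n)\<^sup>2 \<le> 4 / b * B * H" .
    have "4 \<le> 4 / b" using b by (simp add: field_simps)
    from mult_right_mono[OF this, of "H * R"] H1 R0
    have "4 * H * R \<le> 4 / b * R * H" by (simp add: mult_ac)
    then have "2 * (u n)\<^sup>2 + 4 * H * R \<le> 4 / b * B * H + 4 / b * R * H" using 1 by (rule add_mono[rotated])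
    also have "\<dots> = 4 / b * H * (B + R)" by (simp only: distrib_left distrib_right mult_ac)
    finally show "2 * (u n)\<^sup>2 + 4 * H * R \<le> 4 / b * H * (B + R)" .
  qed (use H1 in simp)
  finally have "b / (4 * H\<^sup>2) * S \<le> R + B"
    using b H1 by (simp add: field_simps power2_eq_square)
  moreover have "b\<^sup>2 * S \<le> (\<Sum>k=1..n. real k * flux_drop b (1 / real k) * (u k)\<^sup>2)"
    unfolding S_def sum_distrib_left
  proof (intro sum_mono)
    fix k assume k: "k \<in> {1..n}"
    have "b\<^sup>2 * (1 / real k)\<^sup>2 \<le> flux_drop b (1 / real k)"
      using k by (intro flux_drop_ge b) auto
    from mult_left_mono[OF this, of "real k * (u k)\<^sup>2"] k
    show "b\<^sup>2 * ((u k)\<^sup>2 / real k) \<le> real k * flux_drop b (1 / real k) * (u k)\<^sup>2"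
      by (simp add: power2_eq_square field_simps)
  qed
  ultimately have "(b\<^sup>2 + b / (4 * H\<^sup>2)) * S \<le> energy b n u"
    unfolding energy_decomposition R_def[symmetric] B_def[symmetric] by (simp add: algebra_simps)
  then show ?thesis by (simp add: S_def)
qed

section \<open>A test function for the lower bound\<close>

text \<open>The parabola \<open>t * (L - t)\<close> on \<open>[0, L]\<close>, in \<open>t = ln k\<close> and \<open>L = ln n\<close>. It replaces the
  eigenfunction \<open>sin (\<pi> * t / L)\<close>. Its zero at \<open>k = n\<close> removes the boundary term of the energy, and its
  zero at \<open>k = 1\<close> keeps the excess of the potential small, which is concentrated at small \<open>k\<close>.\<close>

definition log_bump :: "nat \<Rightarrow> nat \<Rightarrow> real" where
  "log_bump n k = ln (real k) * (ln (real n) - ln (real k))"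

text \<open>The slope of the parabola in \<open>t\<close> is at most \<open>L\<close>, and the step from \<open>k - 1\<close> to \<open>k\<close> has length at
  most \<open>2 / k\<close>, so the Dirichlet form contributes at most \<open>4 * L\<^sup>2 / k\<close> at \<open>k\<close>. The excess of the
  potential is at most \<open>(t * (L - t))\<^sup>2 / k\<^sup>2\<close>, and the crude bound \<open>t\<^sup>2 \<le> 4 * k\<close> makes it at most
  \<open>4 * L\<^sup>2 / k\<close> as well. The total is of order \<open>L ^ 3\<close>, against \<open>L ^ 5\<close> for the sum of
  \<open>(log_bump n k)\<^sup>2 / k\<close>.\<close>

lemma energy_log_bump_le:
  assumes b: "0 < b" "b \<le> 1/2" and n: "n \<ge> 1"
  shows "energy b n (log_bump n) \<le> b\<^sup>2 * (\<Sum>k=1..n. (log_bump n k)\<^sup>2 / real k)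
    + 8 * (ln (real n))\<^sup>2 * (\<Sum>k=1..n. 1 / real k)"
proof -
  define L where "L = ln (real n)"
  have lnk: "0 \<le> ln (real k)" "ln (real k) \<le> L" if "1 \<le> k" "k \<le> n" for k
    using that by (auto simp: L_def)
  have grad: "real k powr (1 - b) * real (k - 1) powr b * (log_bump n k - log_bump n (k - 1))\<^sup>2
      \<le> 4 * L\<^sup>2 * (1 / real k)" if k: "k \<in> {1..n}" for k
  proof (cases "k = 1")
    case False
    define s t where "s = ln (real (k - 1))" and "t = ln (real k)"
    have k2: "k \<ge> 2" using False k by simp
    have st: "0 \<le> s" "s \<le> t" "t \<le> L"
      using k k2 lnk[of "k - 1"] lnk[of k] by (auto simp: s_def t_def)
    have "t - s \<le> 1 / real (k - 1)"
      using ln_diff_le_inverse[of "real (k - 1)"] k2 by (simp add: s_def t_def)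
    also have "\<dots> \<le> 2 / real k" using k2 by (simp add: field_simps)
    finally have ts: "t - s \<le> 2 / real k" .
    \<comment> \<open>The chord of \<open>t * (L - t)\<close> from \<open>s\<close> to \<open>t\<close> has slope \<open>L - (s + t)\<close>.\<close>
    have "log_bump n k - log_bump n (k - 1) = (t - s) * (L - (s + t))"
      by (simp add: log_bump_def s_def t_def L_def algebra_simps)
    then have "\<bar>log_bump n k - log_bump n (k - 1)\<bar> = (t - s) * \<bar>L - (s + t)\<bar>"
      using st by (simp add: abs_mult)
    also have "\<dots> \<le> 2 / real k * L"
      using st ts by (intro mult_mono) auto
    finally have "(log_bump n k - log_bump n (k - 1))\<^sup>2 \<le> (2 / real k * L)\<^sup>2"
      by (rule abs_le_square_iff[THEN iffD1, OF order_trans]) (use st in auto)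
    moreover have "real k powr (1 - b) * real (k - 1) powr b \<le> real k powr (1 - b) * real k powr b"
      using b by (intro mult_left_mono powr_mono2) auto
    then have "real k powr (1 - b) * real (k - 1) powr b \<le> real k"
      using k by (simp add: powr_add[symmetric])
    ultimately have "real k powr (1 - b) * real (k - 1) powr b * (log_bump n k - log_bump n (k - 1))\<^sup>2
        \<le> real k * (2 / real k * L)\<^sup>2"
      by (intro mult_mono) auto
    also have "\<dots> = 4 * L\<^sup>2 * (1 / real k)" by (simp add: power2_eq_square)
    finally show ?thesis .
  qed simp
  have pot: "real k * flux_drop b (1 / real k) * (log_bump n k)\<^sup>2
      \<le> b\<^sup>2 * ((log_bump n k)\<^sup>2 / real k) + 4 * L\<^sup>2 * (1 / real k)" if k: "k \<in> {1..n}" for k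
  proof (cases "k = 1")
    case False
    then have k2: "k \<ge> 2" using k by simp
    define t where "t = ln (real k)"
    have t: "0 \<le> t" "t \<le> L" using lnk[of k] k by (auto simp: t_def)
    \<comment> \<open>\<open>ln y \<le> y\<close> at \<open>y = sqrt k\<close> gains the square root that \<open>ln k \<le> k\<close> lacks.\<close>
    have "t = 2 * ln (sqrt (real k))" using k2 by (simp add: t_def ln_sqrt)
    also have "\<dots> \<le> 2 * sqrt (real k)" using k2 ln_le_minus_one[of "sqrt (real k)"] by simp
    finally have "t\<^sup>2 \<le> (2 * sqrt (real k))\<^sup>2" using t by (intro power_mono) auto
    then have tk: "t\<^sup>2 \<le> 4 * real k" by (simp add: power_mult_distrib)
    have "(log_bump n k)\<^sup>2 = t\<^sup>2 * (L - t)\<^sup>2"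
      by (simp add: log_bump_def t_def L_def power_mult_distrib)
    also have "\<dots> \<le> 4 * real k * L\<^sup>2"
      using t tk by (intro mult_mono power_mono) auto
    finally have u: "(log_bump n k)\<^sup>2 \<le> 4 * real k * L\<^sup>2" .
    have "flux_drop b (1 / real k) \<le> b\<^sup>2 * (1 / real k)\<^sup>2 + (1 / real k) ^ 3"
      using k2 by (intro flux_drop_le b) auto
    from mult_left_mono[OF this, of "real k * (log_bump n k)\<^sup>2"]
    have "real k * flux_drop b (1 / real k) * (log_bump n k)\<^sup>2
      \<le> real k * (log_bump n k)\<^sup>2 * (b\<^sup>2 * (1 / real k)\<^sup>2 + (1 / real k) ^ 3)"
      by (simp add: mult_ac)
    also have "\<dots> = b\<^sup>2 * ((log_bump n k)\<^sup>2 / real k) + (log_bump n k)\<^sup>2 / (real k)\<^sup>2"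
      using k2 by (simp add: power2_eq_square power3_eq_cube field_simps)
    also have "(log_bump n k)\<^sup>2 / (real k)\<^sup>2 \<le> 4 * real k * L\<^sup>2 / (real k)\<^sup>2"
      using u by (intro divide_right_mono) auto
    also have "\<dots> = 4 * L\<^sup>2 * (1 / real k)" using k2 by (simp add: power2_eq_square)
    finally show ?thesis by simp
  qed (simp add: log_bump_def)
  have "log_bump n n = 0" by (simp add: log_bump_def)
  then have "energy b n (log_bump n) \<le> (\<Sum>k=1..n. 4 * L\<^sup>2 * (1 / real k))
      + (\<Sum>k=1..n. b\<^sup>2 * ((log_bump n k)\<^sup>2 / real k) + 4 * L\<^sup>2 * (1 / real k))"
    unfolding energy_decomposition using grad pot
    by (simp only: power_zero_numeral mult_zero_right add_0_right) (intro add_mono sum_mono)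
  also have "\<dots> = b\<^sup>2 * (\<Sum>k=1..n. (log_bump n k)\<^sup>2 / real k) + 8 * L\<^sup>2 * (\<Sum>k=1..n. 1 / real k)"
    by (simp add: sum.distrib sum_distrib_left)
  finally show ?thesis by (simp add: L_def)
qed

text \<open>For \<open>n powr (1/4) \<le> k \<le> n powr (3/4)\<close> the parabola is at least \<open>3 / 16 * L\<^sup>2\<close>, and the harmonic sum
  over this block is at least \<open>L / 2 - ln 2\<close>; the rounding of the lower end costs the \<open>ln 2\<close>. For
  \<open>n \<ge> 16\<close> this is at least \<open>L / 4\<close>.\<close>

lemma log_bump_norm_ge:
  assumes n: "n \<ge> 16"
  shows "9 / 1024 * ln (real n) ^ 5 \<le> (\<Sum>k=1..n. (log_bump n k)\<^sup>2 / real k)"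
proof -
  define L where "L = ln (real n)"
  define p where "p = nat \<lceil>real n powr (1/4)\<rceil>"
  define q where "q = nat \<lfloor>real n powr (3/4)\<rfloor>"
  have "ln (16::real) \<le> L" using n by (simp add: L_def)
  moreover have "ln (16::real) = 4 * ln 2" using ln_realpow[of 2 4] by simp
  ultimately have L: "4 * ln 2 \<le> L" by simp
  have ln2: "(0::real) < ln 2" by simp
  have root1: "1 \<le> real n powr (1/4)" using n by (intro ge_one_powr_ge_zero) auto
  have p_lo: "real n powr (1/4) \<le> real p" unfolding p_def by linarith
  have p_hi: "real p \<le> real n powr (1/4) + 1"
    unfolding p_def using root1 by linarith
  have p1: "p \<ge> 1" using p_lo root1 by linarith
  have q_hi: "real q \<le> real n powr (3/4)" unfolding q_def by (simp add: of_nat_floor)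
  have q_lo: "real n powr (3/4) \<le> real q + 1" unfolding q_def by linarith
  have "real n powr (3/4) \<le> real n powr 1" using n by (intro powr_mono) auto
  then have qn: "q \<le> n" using q_hi by simp
  have ln_p: "ln (real p) \<le> L / 4 + ln 2"
  proof -
    have "real p \<le> 2 * real n powr (1/4)" using p_hi root1 by linarith
    then have "ln (real p) \<le> ln (2 * real n powr (1/4))" using p1 by (intro ln_mono) auto
    also have "\<dots> = L / 4 + ln 2" using n by (simp add: ln_mult L_def ln_powr)
    finally show ?thesis .
  qed
  have ln_q: "3 / 4 * L \<le> ln (real q + 1)"
  proof -
    have "3 / 4 * L = ln (real n powr (3/4))" using n by (simp add: L_def ln_powr)
    also have "\<dots> \<le> ln (real q + 1)" using q_lo n by (intro ln_mono) auto
    finally show ?thesis .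
  qed
  have "ln (real p) < ln (real q + 1)" using ln_p ln_q L ln2 by linarith
  then have pq: "p \<le> q + 1" using p1 by simp
  have "L / 4 \<le> (\<Sum>k=p..q. 1 / real k)"
    using harmonic_block_ge[OF p1 pq] ln_p ln_q L by linarith
  then have "(3 / 16 * L\<^sup>2)\<^sup>2 * (L / 4) \<le> (3 / 16 * L\<^sup>2)\<^sup>2 * (\<Sum>k=p..q. 1 / real k)"
    by (intro mult_left_mono) auto
  also have "\<dots> = (\<Sum>k=p..q. (3 / 16 * L\<^sup>2)\<^sup>2 / real k)" by (simp add: sum_distrib_left)
  also have "\<dots> \<le> (\<Sum>k=p..q. (log_bump n k)\<^sup>2 / real k)"
  proof (intro sum_mono divide_right_mono power_mono)
    fix k assume k: "k \<in> {p..q}"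
    define t where "t = ln (real k)"
    have k1: "k \<ge> 1" using k p1 by simp
    have "real n powr (1/4) \<le> real k" using k p_lo by (auto intro: order_trans)
    then have "ln (real n powr (1/4)) \<le> t" unfolding t_def using k1 n by (intro ln_mono) auto
    then have 1: "L / 4 \<le> t" using n by (simp add: ln_powr L_def)
    have "real k \<le> real n powr (3/4)" using k q_hi by (auto intro: order_trans[rotated])
    then have "t \<le> ln (real n powr (3/4))" unfolding t_def using k1 n by (intro ln_mono) auto
    then have 2: "t \<le> 3 / 4 * L" using n by (simp add: ln_powr L_def)
    have "log_bump n k - 3 / 16 * L\<^sup>2 = (t - L / 4) * (3 / 4 * L - t)"
      by (simp add: log_bump_def t_def L_def power2_eq_square field_simps)
    also have "\<dots> \<ge> 0" using 1 2 by simp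
    finally show "3 / 16 * L\<^sup>2 \<le> log_bump n k" by simp
  qed auto
  also have "\<dots> \<le> (\<Sum>k=1..n. (log_bump n k)\<^sup>2 / real k)"
    using p1 qn by (intro sum_mono2) auto
  finally show ?thesis by (simp add: L_def power2_eq_square eval_nat_numeral mult_ac)
qed

section \<open>Bounds for the best constant\<close>

lemma hardy_const_le_improved:
  assumes b: "0 < b" "b \<le> 1/2" and n: "n \<ge> 1"
  defines "H \<equiv> \<Sum>k=1..n. 1 / real k"
  shows "hardy_const n (1 - 2 * b) \<le> 1 / (b\<^sup>2 + b / (4 * H\<^sup>2))"
proof (rule hardy_const_le)
  have pos: "0 < b\<^sup>2 + b / (4 * H\<^sup>2)"
    using b by (intro add_pos_nonneg) auto
  show "weighted_hardy_ineq n (1 - 2 * b) (1 / (b\<^sup>2 + b / (4 * H\<^sup>2)))"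
    unfolding weighted_hardy_ineq_iff_energy
  proof
    fix u :: "nat \<Rightarrow> real"
    show "(\<Sum>k=1..n. (u k)\<^sup>2 / real k) \<le> 1 / (b\<^sup>2 + b / (4 * H\<^sup>2)) * energy b n u"
      using hardy_remainder[OF b n, of u] pos unfolding H_def[symmetric]
      by (simp only: pos_le_divide_eq mult_1 times_divide_eq_left mult.commute[of "sum _ _"])
  qed
qed (use b n in auto)

lemma hardy_const_ge_log:
  assumes b: "0 < b" "b \<le> 1/2" and n: "n \<ge> 16"
  shows "1 / (b\<^sup>2 + 2000 / (ln (real n))\<^sup>2) \<le> hardy_const n (1 - 2 * b)"
proof -
  define L where "L = ln (real n)"
  define S where "S = (\<Sum>k=1..n. (log_bump n k)\<^sup>2 / real k)"
  define d where "d = hardy_const n (1 - 2 * b)"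
  have "exp 1 \<le> real n" using exp_le n by linarith
  then have L1: "1 \<le> L" unfolding L_def using n by (simp add: ln_ge_iff)
  have S: "9 / 1024 * L ^ 5 \<le> S" unfolding S_def L_def by (rule log_bump_norm_ge[OF n])
  then have S0: "0 < S" using L1 by (smt (verit) zero_less_power mult_pos_pos divide_pos_pos)
  have hardy: "weighted_hardy_ineq n (1 - 2 * b) d"
    unfolding d_def using b n by (intro weighted_hardy_ineq_hardy_const) auto
  then have d0: "0 \<le> d" using weighted_hardy_ineq_nonneg[of n] n by auto
  have "(\<Sum>k=1..n. 1 / real k) \<le> 2 * L" using harmonic_sum_le[of n] n L1 by (simp add: L_def)
  then have "8 * L\<^sup>2 * (\<Sum>k=1..n. 1 / real k) \<le> 8 * L\<^sup>2 * (2 * L)"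
    by (intro mult_left_mono) auto
  \<comment> \<open>\<open>16 * L ^ 3\<close> is expressed through the lower bound \<open>9 / 1024 * L ^ 5\<close> of \<open>S\<close>; the factor
    \<open>16384 / 9\<close> is less than \<open>2000\<close>.\<close>
  also have "\<dots> = 16384 / 9 * (9 / 1024 * L ^ 5) / L\<^sup>2"
    using L1 by (simp add: power2_eq_square eval_nat_numeral)
  also have "\<dots> \<le> 2000 * S / L\<^sup>2"
    using S S0 by (intro divide_right_mono) auto
  finally have "energy b n (log_bump n) \<le> (b\<^sup>2 + 2000 / L\<^sup>2) * S"
    using energy_log_bump_le[OF b, of n] n by (simp add: S_def L_def algebra_simps)
  then have "d * energy b n (log_bump n) \<le> d * ((b\<^sup>2 + 2000 / L\<^sup>2) * S)"
    using d0 by (rule mult_left_mono)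
  moreover have "S \<le> d * energy b n (log_bump n)"
    using hardy unfolding weighted_hardy_ineq_iff_energy S_def by blast
  ultimately have "1 * S \<le> (d * (b\<^sup>2 + 2000 / L\<^sup>2)) * S" by (simp add: mult_ac)
  then have "1 \<le> d * (b\<^sup>2 + 2000 / L\<^sup>2)" using S0 by (simp only: mult_le_cancel_right_pos)
  moreover have "0 < b\<^sup>2 + 2000 / L\<^sup>2" using b by (intro add_pos_nonneg) auto
  ultimately show ?thesis by (simp add: pos_divide_le_eq d_def L_def)
qed

theorem corollary1p5:
  fixes \<epsilon> :: real
  assumes "0 \<le> \<epsilon>" and "\<epsilon> < 1"
  shows "\<exists>c1 c2 :: real. c1 > 0 \<and> c2 > 0 \<and>
           (\<forall>n::nat. n \<ge> 2 \<longrightarrow>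
              4 / (1 - \<epsilon>)\<^sup>2 - c1 / (ln (real n))\<^sup>2 \<le> hardy_const n \<epsilon> \<and>
              hardy_const n \<epsilon> \<le> 4 / (1 - \<epsilon>)\<^sup>2 - c2 / (ln (real n))\<^sup>2)"
proof -
  define b where "b = (1 - \<epsilon>) / 2"
  have b: "0 < b" "b \<le> 1/2" and \<epsilon>: "\<epsilon> = 1 - 2 * b"
    using assms by (simp_all add: b_def field_simps)
  have const: "4 / (1 - \<epsilon>)\<^sup>2 = 1 / b\<^sup>2" by (simp add: b_def power_divide)
  have expand: "1 / (b\<^sup>2 + y) = 1 / b\<^sup>2 - y / (b\<^sup>2 * (b\<^sup>2 + y))" if "0 \<le> y" for y
  proof -
    have "0 < b\<^sup>2" using b by simp
    moreover from this have "0 < b\<^sup>2 + y" using that by (rule add_pos_nonneg)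
    ultimately have "1 / b\<^sup>2 - 1 / (b\<^sup>2 + y) = y / (b\<^sup>2 * (b\<^sup>2 + y))"
      by (subst diff_frac_eq) auto
    then show ?thesis by linarith
  qed
  \<comment> \<open>The first summand serves \<open>n \<ge> 16\<close>. The second makes the lower bound nonpositive,
    hence trivial, for \<open>n < 16\<close>.\<close>
  define c1 where "c1 = (2000 / b ^ 4) + (ln 16)\<^sup>2 / b\<^sup>2"
  \<comment> \<open>\<open>K\<close> satisfies \<open>1 + ln n \<le> K * ln n\<close> for all \<open>n \<ge> 2\<close>, so that the harmonic sum in
    \<open>hardy_const_le_improved\<close> can be replaced by a multiple of \<open>ln n\<close>.\<close>
  define K :: real where "K = 1 / ln 2 + 1"
  define \<gamma> where "\<gamma> = b / (4 * K\<^sup>2)"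
  define c2 where "c2 = \<gamma> / (b\<^sup>2 * (b\<^sup>2 + \<gamma> / (ln 2)\<^sup>2))"
  have ln2: "0 < ln (2::real)" by simp
  have K: "K > 0" using ln2 unfolding K_def by (intro add_pos_pos) auto
  have \<gamma>: "\<gamma> > 0" using b K by (simp add: \<gamma>_def)
  have "c1 > 0" unfolding c1_def using b by (intro add_pos_nonneg) auto
  moreover have "c2 > 0" unfolding c2_def using b \<gamma> by (intro divide_pos_pos mult_pos_pos add_pos_nonneg) auto
  moreover have "1 / b\<^sup>2 - c1 / (ln (real n))\<^sup>2 \<le> hardy_const n \<epsilon>" if n: "n \<ge> 2" for n
  proof (cases "n \<ge> 16")
    case True
    define y where "y = 2000 / (ln (real n))\<^sup>2"
    have y: "0 \<le> y" by (simp add: y_def)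
    have "y / (b\<^sup>2 * (b\<^sup>2 + y)) \<le> y / (b\<^sup>2 * b\<^sup>2)"
      using b y by (intro divide_left_mono mult_left_mono mult_pos_pos add_pos_nonneg) auto
    also have "\<dots> = 2000 / b ^ 4 / (ln (real n))\<^sup>2"
      by (simp add: y_def power2_eq_square eval_nat_numeral)
    also have "\<dots> \<le> c1 / (ln (real n))\<^sup>2"
      unfolding c1_def by (intro divide_right_mono) auto
    finally have "1 / b\<^sup>2 - c1 / (ln (real n))\<^sup>2 \<le> 1 / (b\<^sup>2 + y)" using expand[OF y] by simp
    also have "\<dots> \<le> hardy_const n \<epsilon>"
      unfolding y_def \<epsilon> by (rule hardy_const_ge_log[OF b True])
    finally show ?thesis .
  next
    case False
    have lnn: "0 < ln (real n)" "ln (real n) \<le> ln 16" using n False by auto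
    have "1 / b\<^sup>2 * (ln (real n))\<^sup>2 \<le> 1 / b\<^sup>2 * (ln 16)\<^sup>2"
      using lnn by (intro mult_left_mono power_mono) auto
    also have "\<dots> \<le> c1" unfolding c1_def by simp
    finally have "1 / b\<^sup>2 - c1 / (ln (real n))\<^sup>2 \<le> 0" using lnn by (simp add: pos_le_divide_eq)
    also have "0 \<le> hardy_const n \<epsilon>"
      using n assms weighted_hardy_ineq_nonneg[of n \<epsilon>] weighted_hardy_ineq_hardy_const[of n \<epsilon>]
      by auto
    finally show ?thesis .
  qed
  moreover have "hardy_const n \<epsilon> \<le> 1 / b\<^sup>2 - c2 / (ln (real n))\<^sup>2" if n: "n \<ge> 2" for n
  proof -
    define L where "L = ln (real n)"
    define H where "H = (\<Sum>k=1..n. 1 / real k)"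
    define y where "y = \<gamma> / L\<^sup>2"
    have L: "ln 2 \<le> L" using n by (simp add: L_def)
    then have L0: "0 < L" using ln2 by linarith
    have "1 \<le> L / ln 2" using L ln2 by simp
    moreover have "H \<le> 1 + L" using harmonic_sum_le[of n] n by (simp add: H_def L_def)
    moreover have "K * L = L / ln 2 + L" by (simp add: K_def distrib_right)
    ultimately have "H \<le> K * L" by linarith
    moreover have "0 < H" unfolding H_def using n by (intro sum_pos) auto
    ultimately have "H\<^sup>2 \<le> (K * L)\<^sup>2" by (intro power_mono) auto
    then have "b / (4 * (K * L)\<^sup>2) \<le> b / (4 * H\<^sup>2)"
      using b \<open>0 < H\<close> K L0 by (intro divide_left_mono) auto
    moreover have "b / (4 * (K * L)\<^sup>2) = y" by (simp add: y_def \<gamma>_def power_mult_distrib)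
    ultimately have yH: "y \<le> b / (4 * H\<^sup>2)" by simp
    have y0: "0 \<le> y" using \<gamma> by (simp add: y_def)
    have "hardy_const n \<epsilon> \<le> 1 / (b\<^sup>2 + b / (4 * H\<^sup>2))"
      unfolding \<epsilon> H_def using b n by (intro hardy_const_le_improved) auto
    also have "\<dots> \<le> 1 / (b\<^sup>2 + y)"
      using yH y0 b by (intro divide_left_mono mult_pos_pos add_pos_nonneg) auto
    also have "\<dots> = 1 / b\<^sup>2 - y / (b\<^sup>2 * (b\<^sup>2 + y))" by (rule expand[OF y0])
    also have "\<dots> \<le> 1 / b\<^sup>2 - c2 / L\<^sup>2"
    proof -
      have "(ln 2)\<^sup>2 \<le> L\<^sup>2" using L ln2 by (intro power_mono) auto
      then have "y \<le> \<gamma> / (ln 2)\<^sup>2"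
        unfolding y_def using \<gamma> ln2 L0 by (intro divide_left_mono) auto
      then have "y / (b\<^sup>2 * (b\<^sup>2 + \<gamma> / (ln 2)\<^sup>2)) \<le> y / (b\<^sup>2 * (b\<^sup>2 + y))"
        using b y0 by (intro divide_left_mono mult_left_mono mult_pos_pos add_pos_nonneg) auto
      moreover have "y / (b\<^sup>2 * (b\<^sup>2 + \<gamma> / (ln 2)\<^sup>2)) = c2 / L\<^sup>2"
        unfolding c2_def y_def by (simp only: divide_divide_eq_left mult.commute)
      ultimately show ?thesis by linarith
    qed
    finally show ?thesis by (simp add: L_def)
  qed
  ultimately show ?thesis unfolding const by blast
qed

end
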